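(* Let $G$ be a finitely generated group. The following are equivalent: (1) $G$ is virtually nilpotent; (2) $G$ is hyper-FC central; (3) $G$ has no non-trivial ICC quotients.
   Context: An element $g$ of a group $G$ is an FC-element if it has only finitely many conjugates in $G$. The FC-center of $G$ is the set of all FC-elements of $G$. The upper FC-series of $G$ is the transfinite series $\{e\}=F_0\leqslant F_1\leqslant\cdots\leqslant F_\alpha\leqslant\cdots$ of subgroups of $G$ in which $F_{\alpha+1}/F_\alpha$ is the set of all FC-elements of $G/F_\alpha$ and $F_\beta=\bigcup_{\alpha<\beta}F_\alpha$ for limit ordinals $\beta$. This series stabilizes at some ordinal; if $\gamma$ is the least ordinal at which it stabilizes, then $F_\gamma$ is called the hyper-FC center of $G$. The group $G$ is called hyper-FC central if it equals its hyper-FC center. A group is ICC (has the infinite conjugacy class property) if every non-identity element has infinitely many conjugates; the trivial group is ICC under this convention. An ICC quotient of $G$ is a quotient group of $G$ that is ICC. A group is virtually nilpotent if it has a nilpotent subgroup of finite index. *)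

theory Defs
  imports "HOL-Algebra.Generated_Groups"
begin

section \<open>Finite generation and virtual nilpotency\<close>

definition finitely_generated_group :: "('a, 'b) monoid_scheme \<Rightarrow> bool" where
  "finitely_generated_group G \<longleftrightarrow>
     (\<exists>S \<subseteq> carrier G. finite S \<and> generate G S = carrier G)"

primrec lower_central_series :: "('a, 'b) monoid_scheme \<Rightarrow> nat \<Rightarrow> 'a set" where
  "lower_central_series G 0 = carrier G"
| "lower_central_series G (Suc n) =
     generate G (\<Union>x \<in> lower_central_series G n. \<Union>y \<in> carrier G.
       {x \<otimes>\<^bsub>G\<^esub> y \<otimes>\<^bsub>G\<^esub> inv\<^bsub>G\<^esub> x \<otimes>\<^bsub>G\<^esub> inv\<^bsub>G\<^esub> y})"

definition nilpotent_group :: "('a, 'b) monoid_scheme \<Rightarrow> bool" where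
  "nilpotent_group G \<longleftrightarrow> (\<exists>n. lower_central_series G n = {\<one>\<^bsub>G\<^esub>})"

definition virtually_nilpotent :: "('a, 'b) monoid_scheme \<Rightarrow> bool" where
  "virtually_nilpotent G \<longleftrightarrow>
     (\<exists>H. subgroup H G \<and> finite (rcosets\<^bsub>G\<^esub> H) \<and> nilpotent_group (G\<lparr>carrier := H\<rparr>))"


section \<open>Conjugacy classes, FC-elements, ICC groups\<close>

definition conjugates :: "('a, 'b) monoid_scheme \<Rightarrow> 'a \<Rightarrow> 'a set" where
  "conjugates G g = (\<lambda>x. x \<otimes>\<^bsub>G\<^esub> g \<otimes>\<^bsub>G\<^esub> inv\<^bsub>G\<^esub> x) ` carrier G"

definition fc_center :: "('a, 'b) monoid_scheme \<Rightarrow> 'a set" where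
  "fc_center G = {g \<in> carrier G. finite (conjugates G g)}"

definition icc_group :: "('a, 'b) monoid_scheme \<Rightarrow> bool" where
  "icc_group G \<longleftrightarrow> (\<forall>g \<in> carrier G. g \<noteq> \<one>\<^bsub>G\<^esub> \<longrightarrow> infinite (conjugates G g))"


section \<open>The upper FC-series\<close>

text \<open>The subgroup of \<open>G\<close> containing \<open>N\<close> whose image in \<open>G / N\<close> is the FC-center of \<open>G / N\<close>.\<close>

definition fc_step :: "('a, 'b) monoid_scheme \<Rightarrow> 'a set \<Rightarrow> 'a set" where
  "fc_step G N = {g \<in> carrier G. N #>\<^bsub>G\<^esub> g \<in> fc_center (G Mod N)}"

text \<open>
  Ordinals are represented by the elements of the field of a (non-strict) well-order \<open>r\<close>:
  \<open>\<alpha>\<close> is the least element iff \<open>underS r \<alpha> = {}\<close>, and \<open>\<alpha>\<close> is the successor of \<open>\<beta>\<close> iff the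
  elements strictly below \<open>\<alpha>\<close> are those below or equal to \<open>\<beta>\<close>. See \<open>upper_fc_series_zero\<close>,
  \<open>upper_fc_series_succ\<close> and \<open>upper_fc_series_limit\<close> below for the recursion equations.
\<close>

definition upper_fc_series :: "('a, 'b) monoid_scheme \<Rightarrow> 'i rel \<Rightarrow> 'i \<Rightarrow> 'a set" where
  "upper_fc_series G r = wo_rel.worec r (\<lambda>F \<alpha>.
     if underS r \<alpha> = {} then {\<one>\<^bsub>G\<^esub>}
     else if \<exists>\<beta>. underS r \<alpha> = under r \<beta>
       then fc_step G (F (THE \<beta>. underS r \<alpha> = under r \<beta>))
     else (\<Union>\<beta> \<in> underS r \<alpha>. F \<beta>))"

text \<open>
  All ordinals below the successor cardinal of \<open>card_of (carrier G)\<close>. The series always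
  becomes stationary within this range; see \<open>fc_step_hyper_fc_center\<close>.
\<close>

definition fc_ordinals :: "('a, 'b) monoid_scheme \<Rightarrow> 'a set rel" where
  "fc_ordinals G = cardSuc (card_of (carrier G))"

definition fc_stable :: "('a, 'b) monoid_scheme \<Rightarrow> 'i rel \<Rightarrow> 'i \<Rightarrow> bool" where
  "fc_stable G r \<gamma> \<longleftrightarrow> \<gamma> \<in> Field r \<and>
     (\<forall>\<beta>. (\<gamma>, \<beta>) \<in> r \<longrightarrow> upper_fc_series G r \<beta> = upper_fc_series G r \<gamma>)"

definition hyper_fc_center :: "('a, 'b) monoid_scheme \<Rightarrow> 'a set" where
  "hyper_fc_center G =
     upper_fc_series G (fc_ordinals G)
       (wo_rel.minim (fc_ordinals G) {\<gamma>. fc_stable G (fc_ordinals G) \<gamma>})"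

definition hyper_fc_central :: "('a, 'b) monoid_scheme \<Rightarrow> bool" where
  "hyper_fc_central G \<longleftrightarrow> hyper_fc_center G = carrier G"


section \<open>Recursion equations\<close>

lemma upper_fc_series_rec:
  assumes "Well_order r"
  shows "upper_fc_series G r \<alpha> =
    (if underS r \<alpha> = {} then {\<one>\<^bsub>G\<^esub>}
     else if \<exists>\<beta>. underS r \<alpha> = under r \<beta>
       then fc_step G (upper_fc_series G r (THE \<beta>. underS r \<alpha> = under r \<beta>))
     else (\<Union>\<beta> \<in> underS r \<alpha>. upper_fc_series G r \<beta>))"
proof -
  interpret wo_rel r using assms by (simp add: wo_rel_def)
  have un: "(THE \<beta>. underS \<alpha> = under \<beta>) = \<beta>" if "underS \<alpha> \<noteq> {}" "underS \<alpha> = under \<beta>" for \<alpha> \<beta>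
  proof (rule the_equality)
    fix \<delta> assume "underS \<alpha> = under \<delta>"
    then have "under \<delta> = under \<beta>" "under \<beta> \<noteq> {}" using that by auto
    then have "\<delta> \<in> Field r" "\<beta> \<in> Field r"
      by (auto simp: under_def Field_def)
    then have "\<delta> \<in> under \<delta>" "\<beta> \<in> under \<beta>"
      using REFL by (auto simp: under_def refl_on_def)
    then show "\<delta> = \<beta>"
      using \<open>under \<delta> = under \<beta>\<close> ANTISYM by (auto simp: under_def antisym_def)
  qed (use that in auto)
  have mem: "(THE \<beta>. underS \<alpha> = under \<beta>) \<in> underS \<alpha>"
    if ne: "underS \<alpha> \<noteq> {}" and ex: "\<exists>\<beta>. underS \<alpha> = under \<beta>" for \<alpha>
  proof -
    obtain \<beta> where b: "underS \<alpha> = under \<beta>" using ex by blast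
    then have "\<beta> \<in> Field r" using ne by (auto simp: under_def Field_def)
    then have "\<beta> \<in> under \<beta>" using REFL by (auto simp: under_def refl_on_def)
    then show ?thesis using un[OF ne b] b by simp
  qed
  have "adm_wo (\<lambda>F \<alpha>. if underS \<alpha> = {} then {\<one>\<^bsub>G\<^esub>}
     else if \<exists>\<beta>. underS \<alpha> = under \<beta>
       then fc_step G (F (THE \<beta>. underS \<alpha> = under \<beta>))
     else (\<Union>\<beta> \<in> underS \<alpha>. F \<beta>))"
    unfolding adm_wo_def using mem by auto
  from worec_fixpoint[OF this] show ?thesis
    unfolding upper_fc_series_def by (rule fun_cong)
qed

lemma upper_fc_series_zero:
  assumes "Well_order r" "underS r \<alpha> = {}"
  shows "upper_fc_series G r \<alpha> = {\<one>\<^bsub>G\<^esub>}"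
  using assms by (simp add: upper_fc_series_rec)

lemma upper_fc_series_succ:
  assumes wo: "Well_order r" and b: "\<beta> \<in> Field r" and eq: "underS r \<alpha> = under r \<beta>"
  shows "upper_fc_series G r \<alpha> = fc_step G (upper_fc_series G r \<beta>)"
proof -
  interpret wo_rel r using wo by (simp add: wo_rel_def)
  have bb: "\<beta> \<in> under \<beta>" using REFL b by (auto simp: under_def refl_on_def)
  have "(THE \<beta>. underS \<alpha> = under \<beta>) = \<beta>"
  proof (rule the_equality)
    fix \<delta> assume "underS \<alpha> = under \<delta>"
    then have d: "under \<delta> = under \<beta>" using eq by auto
    then have "\<delta> \<in> Field r" using bb by (auto simp: under_def Field_def)
    then have "\<delta> \<in> under \<delta>" using REFL by (auto simp: under_def refl_on_def)
    then show "\<delta> = \<beta>"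
      using bb d ANTISYM by (auto simp: under_def antisym_def)
  qed (rule eq)
  then show ?thesis
    using upper_fc_series_rec[OF wo, of G \<alpha>] eq bb by auto
qed

lemma upper_fc_series_limit:
  assumes "Well_order r" "underS r \<alpha> \<noteq> {}" "\<nexists>\<beta>. underS r \<alpha> = under r \<beta>"
  shows "upper_fc_series G r \<alpha> = (\<Union>\<beta> \<in> underS r \<alpha>. upper_fc_series G r \<beta>)"
  using assms by (simp add: upper_fc_series_rec)


section \<open>The series consists of normal subgroups, increases, and becomes stationary\<close>

context group
begin

lemma fc_center_subgroup: "subgroup (fc_center G) G"
proof (rule subgroupI)
  show "fc_center G \<subseteq> carrier G" by (auto simp: fc_center_def)
  have "conjugates G \<one> \<subseteq> {\<one>}" by (auto simp: conjugates_def)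
  then show "fc_center G \<noteq> {}" by (auto simp: fc_center_def dest: finite_subset)
next
  fix a assume a: "a \<in> fc_center G"
  have "conjugates G (inv a) \<subseteq> (\<lambda>x. inv x) ` conjugates G a"
  proof
    fix y assume "y \<in> conjugates G (inv a)"
    then obtain x where x: "x \<in> carrier G" "y = x \<otimes> inv a \<otimes> inv x"
      by (auto simp: conjugates_def)
    moreover have "inv (x \<otimes> a \<otimes> inv x) = x \<otimes> inv a \<otimes> inv x"
      using a x by (simp add: fc_center_def inv_mult_group m_assoc)
    ultimately show "y \<in> (\<lambda>x. inv x) ` conjugates G a"
      by (force simp: conjugates_def)
  qed
  then show "inv a \<in> fc_center G"
    using a by (auto simp: fc_center_def intro: finite_subset)
next
  fix a b assume a: "a \<in> fc_center G" and b: "b \<in> fc_center G"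
  have "conjugates G (a \<otimes> b) \<subseteq> (\<lambda>(x, y). x \<otimes> y) ` (conjugates G a \<times> conjugates G b)"
  proof
    fix y assume "y \<in> conjugates G (a \<otimes> b)"
    then obtain x where x: "x \<in> carrier G" "y = x \<otimes> (a \<otimes> b) \<otimes> inv x"
      by (auto simp: conjugates_def)
    have "inv x \<otimes> (x \<otimes> (b \<otimes> inv x)) = b \<otimes> inv x"
      using b x by (simp add: fc_center_def flip: m_assoc)
    then have "y = (x \<otimes> a \<otimes> inv x) \<otimes> (x \<otimes> b \<otimes> inv x)"
      using a b x by (simp add: fc_center_def m_assoc)
    then show "y \<in> (\<lambda>(x, y). x \<otimes> y) ` (conjugates G a \<times> conjugates G b)"
      using x by (auto simp: conjugates_def)
  qed
  then show "a \<otimes> b \<in> fc_center G"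
    using a b by (auto simp: fc_center_def intro: finite_subset)
qed

lemma fc_center_normal: "fc_center G \<lhd> G"
  unfolding normal_inv_iff
proof (intro conjI ballI)
  fix x h assume x: "x \<in> carrier G" and h: "h \<in> fc_center G"
  have "conjugates G (x \<otimes> h \<otimes> inv x) \<subseteq> conjugates G h"
  proof
    fix y assume "y \<in> conjugates G (x \<otimes> h \<otimes> inv x)"
    then obtain z where "z \<in> carrier G" "y = z \<otimes> (x \<otimes> h \<otimes> inv x) \<otimes> inv z"
      by (auto simp: conjugates_def)
    then have "z \<otimes> x \<in> carrier G" "y = (z \<otimes> x) \<otimes> h \<otimes> inv (z \<otimes> x)"
      using x h by (auto simp: fc_center_def inv_mult_group m_assoc)
    then show "y \<in> conjugates G h" by (auto simp: conjugates_def)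
  qed
  then show "x \<otimes> h \<otimes> inv x \<in> fc_center G"
    using x h by (auto simp: fc_center_def intro: finite_subset)
qed (rule fc_center_subgroup)

lemma fc_step_normal:
  assumes N: "N \<lhd> G"
  shows "fc_step G N \<lhd> G"
proof -
  interpret N: normal N G by (rule N)
  interpret Q: group "G Mod N" by (rule N.factorgroup_is_group)
  interpret h: group_hom G "G Mod N" "\<lambda>g. N #> g"
    by unfold_locales (rule N.r_coset_hom_Mod)
  interpret Z: normal "fc_center (G Mod N)" "G Mod N" by (rule Q.fc_center_normal)
  show ?thesis
    unfolding normal_inv_iff
  proof (intro conjI ballI subgroupI)
    show "fc_step G N \<noteq> {}"
      using Z.one_closed h.hom_one by (auto simp: fc_step_def)
    show "fc_step G N \<subseteq> carrier G" by (auto simp: fc_step_def)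
    show "inv a \<in> fc_step G N" if "a \<in> fc_step G N" for a
      using that Z.m_inv_closed[of "N #> a"] h.hom_inv[of a] by (simp add: fc_step_def)
    show "a \<otimes> b \<in> fc_step G N" if "a \<in> fc_step G N" "b \<in> fc_step G N" for a b
      using that Z.m_closed[of "N #> a" "N #> b"] h.hom_mult[of a b]
      by (simp add: fc_step_def del: mult_FactGroup)
    show "x \<otimes> h \<otimes> inv x \<in> fc_step G N" if x: "x \<in> carrier G" and "h \<in> fc_step G N" for x h
    proof -
      have h: "h \<in> carrier G" "N #> h \<in> fc_center (G Mod N)"
        using that by (auto simp: fc_step_def)
      have "N #> (x \<otimes> h \<otimes> inv x) =
          (N #> x) \<otimes>\<^bsub>G Mod N\<^esub> (N #> h) \<otimes>\<^bsub>G Mod N\<^esub> inv\<^bsub>G Mod N\<^esub> (N #> x)"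
        by (simp only: h.hom_mult h.hom_inv x h m_closed inv_closed)
      then show ?thesis
        using Z.inv_op_closed2[OF h.hom_closed[OF x] h(2)] x h
        by (simp only: fc_step_def mem_Collect_eq m_closed inv_closed)
    qed
  qed
qed

lemma fc_step_increasing:
  assumes N: "N \<lhd> G"
  shows "N \<subseteq> fc_step G N"
proof
  interpret N: normal N G by (rule N)
  interpret Q: group "G Mod N" by (rule N.factorgroup_is_group)
  fix g assume g: "g \<in> N"
  then have "N #> g = \<one>\<^bsub>G Mod N\<^esub>" by (simp add: FactGroup_def N.rcos_const)
  then show "g \<in> fc_step G N"
    using g subgroup.one_closed[OF Q.fc_center_subgroup] by (simp add: fc_step_def)
qed

lemma upper_fc_series_normal_mono:
  assumes wo: "Well_order r"
  shows "upper_fc_series G r \<alpha> \<lhd> G \<and>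
    (\<forall>\<beta> \<in> underS r \<alpha>. fc_step G (upper_fc_series G r \<beta>) \<subseteq> upper_fc_series G r \<alpha>)"
proof -
  interpret wo_rel r using wo by (simp add: wo_rel_def)
  let ?F = "upper_fc_series G r"
  show ?thesis
  proof (induction \<alpha> rule: well_order_induct)
    case (1 \<alpha>)
    then have nor: "?F \<beta> \<lhd> G" if "\<beta> \<in> underS \<alpha>" for \<beta>
      using that by (auto simp: underS_def)
    from 1 have step: "fc_step G (?F \<delta>) \<subseteq> ?F \<beta>" if "\<beta> \<in> underS \<alpha>" "\<delta> \<in> underS \<beta>" for \<beta> \<delta>
      using that by (auto simp: underS_def)
    have under_cases: "\<delta> = \<beta> \<or> \<delta> \<in> underS \<beta> \<or> \<beta> \<in> underS \<delta>"
      if "\<beta> \<in> underS \<alpha>" "\<delta> \<in> underS \<alpha>" for \<beta> \<delta>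
      using that TOTALS by (auto simp: underS_def Field_def)
    consider "underS \<alpha> = {}" | \<beta> where "underS \<alpha> \<noteq> {}" "underS \<alpha> = under \<beta>"
      | "underS \<alpha> \<noteq> {}" "\<nexists>\<beta>. underS \<alpha> = under \<beta>" by blast
    then show ?case
    proof cases
      case 1
      then show ?thesis
        using upper_fc_series_zero[OF wo, where G=G] one_is_normal by auto
    next
      case (2 \<beta>)
      then have b: "\<beta> \<in> Field r" by (auto simp: under_def Field_def)
      then have mem: "\<beta> \<in> underS \<alpha>" using 2 REFL by (auto simp: under_def refl_on_def)
      have eq: "?F \<alpha> = fc_step G (?F \<beta>)" using upper_fc_series_succ[OF wo b, where G=G] 2 by auto
      have "fc_step G (?F \<delta>) \<subseteq> ?F \<alpha>" if d: "\<delta> \<in> underS \<alpha>" for \<delta>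
      proof (cases "\<delta> = \<beta>")
        case False
        then have "\<delta> \<in> underS \<beta>" using d 2 by (auto simp: under_def underS_def)
        then show ?thesis
          using step[OF mem] fc_step_increasing[OF nor[OF mem]] eq by blast
      qed (use eq in auto)
      then show ?thesis using eq fc_step_normal[OF nor[OF mem]] by auto
    next
      case 3
      then have eq: "?F \<alpha> = (\<Union>\<beta> \<in> underS \<alpha>. ?F \<beta>)" by (rule upper_fc_series_limit[OF wo])
      have chain: "?F \<delta> \<subseteq> ?F \<beta> \<or> ?F \<beta> \<subseteq> ?F \<delta>" if "\<beta> \<in> underS \<alpha>" "\<delta> \<in> underS \<alpha>" for \<beta> \<delta>
        using under_cases[OF that] step fc_step_increasing nor that by blast
      have "?F \<alpha> \<lhd> G"
        unfolding normal_inv_iff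
      proof (intro conjI ballI subgroupI)
        show "?F \<alpha> \<subseteq> carrier G"
          unfolding eq using nor by (blast dest: normal_imp_subgroup subgroup.mem_carrier)
        show "?F \<alpha> \<noteq> {}"
        proof -
          obtain \<beta> where b: "\<beta> \<in> underS \<alpha>" using 3 by blast
          then have "\<one> \<in> ?F \<beta>"
            using nor by (blast intro: subgroup.one_closed normal_imp_subgroup)
          then show ?thesis using b eq by blast
        qed
        show "inv a \<in> ?F \<alpha>" if "a \<in> ?F \<alpha>" for a
          using that nor unfolding eq
          by (blast dest: normal_imp_subgroup subgroup.m_inv_closed)
        show "x \<otimes> h \<otimes> inv x \<in> ?F \<alpha>" if "x \<in> carrier G" "h \<in> ?F \<alpha>" for x h
          using that nor unfolding eq by (blast dest: normal.inv_op_closed2)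
        show "a \<otimes> b \<in> ?F \<alpha>" if ab: "a \<in> ?F \<alpha>" "b \<in> ?F \<alpha>" for a b
        proof -
          obtain \<beta> \<delta> where bd: "\<beta> \<in> underS \<alpha>" "\<delta> \<in> underS \<alpha>" "a \<in> ?F \<beta>" "b \<in> ?F \<delta>"
            using ab eq by auto
          then obtain \<epsilon> where "\<epsilon> \<in> underS \<alpha>" "a \<in> ?F \<epsilon>" "b \<in> ?F \<epsilon>"
            using chain[OF bd(1,2)] by blast
          then show ?thesis
            using nor unfolding eq by (blast intro: subgroup.m_closed normal_imp_subgroup)
        qed
      qed
      moreover have "fc_step G (?F \<beta>) \<subseteq> ?F \<alpha>" if b: "\<beta> \<in> underS \<alpha>" for \<beta>
      proof -
        have "under \<beta> \<subseteq> underS \<alpha>"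
          using b TRANS ANTISYM by (auto simp: under_def underS_def antisym_def dest: transD)
        then obtain \<delta> where d: "\<delta> \<in> underS \<alpha>" "\<delta> \<notin> under \<beta>" using 3 by blast
        then have "\<beta> \<in> underS \<delta>"
          using under_cases[OF b d(1)] b REFL
          by (auto simp: under_def underS_def refl_on_def Field_def)
        then show ?thesis using step[OF d(1)] d eq by blast
      qed
      ultimately show ?thesis by blast
    qed
  qed
qed

lemma upper_fc_series_normal:
  "Well_order r \<Longrightarrow> upper_fc_series G r \<alpha> \<lhd> G"
  by (rule upper_fc_series_normal_mono [THEN conjunct1])

lemma upper_fc_series_mono:
  assumes "Well_order r" "(\<beta>, \<alpha>) \<in> r"
  shows "upper_fc_series G r \<beta> \<subseteq> upper_fc_series G r \<alpha>"
proof (cases "\<beta> = \<alpha>")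
  case False
  then have "\<beta> \<in> underS r \<alpha>" using assms by (auto simp: underS_def)
  then show ?thesis
    using upper_fc_series_normal_mono[OF assms(1), of \<alpha>]
      fc_step_increasing[OF upper_fc_series_normal[OF assms(1)], of \<beta>] by blast
qed auto

lemma fc_stableI:
  assumes wo: "Well_order r" and c: "\<gamma> \<in> Field r"
    and stat: "fc_step G (upper_fc_series G r \<gamma>) = upper_fc_series G r \<gamma>"
  shows "fc_stable G r \<gamma>"
proof -
  interpret wo_rel r using wo by (simp add: wo_rel_def)
  let ?F = "upper_fc_series G r"
  have "(\<gamma>, \<beta>) \<in> r \<longrightarrow> ?F \<beta> = ?F \<gamma>" for \<beta>
  proof (induction \<beta> rule: well_order_induct)
    case (1 \<beta>)
    show ?case
    proof (rule impI)
      assume cb: "(\<gamma>, \<beta>) \<in> r"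
      show "?F \<beta> = ?F \<gamma>"
      proof (cases "\<gamma> = \<beta>")
        case False
        then have mem: "\<gamma> \<in> underS \<beta>" using cb by (auto simp: underS_def)
        have sub: "?F \<delta> \<subseteq> ?F \<gamma>" if d: "\<delta> \<in> underS \<beta>" for \<delta>
        proof -
          have "(\<delta>, \<gamma>) \<in> r \<or> (\<gamma>, \<delta>) \<in> r"
            using TOTALS c d by (auto simp: underS_def Field_def)
          then show ?thesis
            using 1 d upper_fc_series_mono[OF wo] by (auto simp: underS_def)
        qed
        have "?F \<beta> \<subseteq> ?F \<gamma>"
        proof (cases "\<exists>\<delta>. underS \<beta> = under \<delta>")
          case True
          then obtain \<delta> where d: "underS \<beta> = under \<delta>" by blast
          then have dF: "\<delta> \<in> Field r" and "(\<gamma>, \<delta>) \<in> r"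
            using mem by (auto simp: under_def Field_def)
          moreover have "\<delta> \<in> underS \<beta>" using d dF REFL by (auto simp: under_def refl_on_def)
          ultimately have "?F \<delta> = ?F \<gamma>" using 1 by (auto simp: underS_def)
          then show ?thesis using upper_fc_series_succ[OF wo dF d, where G=G] stat by auto
        next
          case False
          then show ?thesis
            using upper_fc_series_limit[OF wo _ False, where G=G] mem sub by blast
        qed
        then show ?thesis using upper_fc_series_mono[OF wo cb] by blast
      qed auto
    qed
  qed
  then show ?thesis using c by (simp add: fc_stable_def)
qed

lemma Well_order_fc_ordinals: "Well_order (fc_ordinals G)"
  unfolding fc_ordinals_def
  using cardSuc_Card_order[OF card_of_Card_order] card_order_on_well_order_on by blast

text \<open>Hence the series is constant from the hyper-FC center on.\<close>

lemma fc_step_hyper_fc_center: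
  "fc_step G (hyper_fc_center G) = hyper_fc_center G"
proof -
  let ?r = "fc_ordinals G"
  let ?F = "upper_fc_series G ?r"
  note wo = Well_order_fc_ordinals
  interpret wo_rel ?r using wo by (simp add: wo_rel_def)
  have "\<exists>\<gamma> \<in> Field ?r. fc_step G (?F \<gamma>) = ?F \<gamma>"
  proof (rule ccontr)
    assume "\<not> ?thesis"
    then have "\<forall>\<gamma> \<in> Field ?r. \<exists>x. x \<in> fc_step G (?F \<gamma>) - ?F \<gamma>"
      using fc_step_increasing[OF upper_fc_series_normal[OF wo]] by blast
    then obtain x where x: "\<And>\<gamma>. \<gamma> \<in> Field ?r \<Longrightarrow> x \<gamma> \<in> fc_step G (?F \<gamma>) - ?F \<gamma>"
      by metis
    have ne: "x \<beta> \<noteq> x \<alpha>" if "\<beta> \<in> underS \<alpha>" "\<alpha> \<in> Field ?r" "\<beta> \<in> Field ?r" for \<alpha> \<beta>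
    proof -
      have "x \<beta> \<in> upper_fc_series G ?r \<alpha>"
        using upper_fc_series_normal_mono[OF wo, of \<alpha>] x[OF that(3)] that(1) by auto
      then show ?thesis using x[OF that(2)] by auto
    qed
    have "inj_on x (Field ?r)"
    proof (rule inj_onI, rule ccontr)
      fix \<alpha> \<beta> assume a: "\<alpha> \<in> Field ?r" "\<beta> \<in> Field ?r" "x \<alpha> = x \<beta>" "\<alpha> \<noteq> \<beta>"
      then have "\<beta> \<in> underS \<alpha> \<or> \<alpha> \<in> underS \<beta>" using TOTALS by (auto simp: underS_def)
      then show False using ne a by metis
    qed
    moreover have "x ` Field ?r \<subseteq> carrier G" using x by (auto simp: fc_step_def)
    ultimately have "ordLeq3 (card_of (Field ?r)) (card_of (carrier G))"
      using card_of_ordLeq by blast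
    moreover have "ordIso2 (card_of (Field ?r)) ?r"
      unfolding fc_ordinals_def
      by (intro card_of_Field_ordIso cardSuc_Card_order card_of_Card_order)
    ultimately have "ordLeq3 ?r (card_of (carrier G))"
      using ordIso_ordLeq_trans ordIso_symmetric by blast
    moreover have "ordLess2 (card_of (carrier G)) ?r"
      unfolding fc_ordinals_def by (intro cardSuc_greater card_of_Card_order)
    ultimately show False using not_ordLess_ordLeq by blast
  qed
  then obtain \<gamma> where c: "\<gamma> \<in> Field ?r" "fc_step G (?F \<gamma>) = ?F \<gamma>" by blast
  let ?S = "{\<gamma>. fc_stable G ?r \<gamma>}"
  have S: "?S \<subseteq> Field ?r" "\<gamma> \<in> ?S" using fc_stableI[OF wo c] by (auto simp: fc_stable_def)
  have "minim ?S \<in> ?S"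
    using minim_in[OF S(1)] S(2) by blast
  moreover have "(minim ?S, \<gamma>) \<in> ?r"
    by (rule minim_least[OF S])
  ultimately have "?F \<gamma> = hyper_fc_center G"
    unfolding hyper_fc_center_def fc_stable_def by blast
  then show ?thesis using c by simp
qed

end

end

theory Submission
  imports Defs
begin

text \<open>
  All three conditions are compared with a fourth one: the only normal subgroup \<open>N\<close> with
  \<open>fc_step G N = N\<close> is \<open>G\<close> itself. As \<open>fc_step G N = N\<close> says that \<open>G / N\<close> is ICC
  (\<open>icc_group_Mod_iff\<close>), this is a reformulation of (3). It is equivalent to (2) because the
  hyper-FC center is the least normal subgroup \<open>N\<close> with \<open>fc_step G N = N\<close>: \<open>fc_step\<close> is
  monotone, so every term of the upper FC-series lies below every such \<open>N\<close>
  (\<open>hyper_fc_center_least\<close>).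

  If a subgroup \<open>H\<close> of finite index is nilpotent and \<open>fc_step G N = N\<close>, then \<open>N\<close> swallows the
  lower central series of \<open>H\<close> from the bottom upwards: when \<open>N\<close> contains one term, the preceding
  term is centralized by \<open>H\<close> modulo \<open>N\<close>, so its elements are FC-elements modulo \<open>N\<close>. Hence
  \<open>H \<subseteq> N\<close>, the quotient \<open>G / N\<close> is finite, and \<open>N = G\<close>
  (\<open>virtually_nilpotent_imp_no_proper_fc_closed\<close>).

  Conversely, let \<open>G\<close> be finitely generated and not virtually nilpotent. The normal subgroups
  \<open>N\<close> for which \<open>G / N\<close> is not virtually nilpotent are closed under unions of chains. The reason
  is that nilpotency of a finitely generated group is decided by finitely many elements, the
  iterated commutators of its generators (\<open>lower_central_series_subset_normal\<close>), and that a
  subgroup of finite index in \<open>G\<close> is again finitely generated (\<open>finitely_generated_finite_index\<close>).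
  So there is a maximal such \<open>N\<close>, by Zorn's lemma. Suppose that \<open>x\<close> is an FC-element modulo \<open>N\<close>
  outside \<open>N\<close>. The centralizer \<open>C\<close> of the conjugacy class of \<open>x\<close> modulo \<open>N\<close> has finite index, and
  the centralizer \<open>M\<close> of \<open>C\<close> modulo \<open>N\<close> is normal and contains \<open>N\<close> and \<open>x\<close>. By maximality a
  subgroup \<open>H\<close> of finite index is nilpotent modulo \<open>M\<close>; then \<open>H \<inter> C\<close> is nilpotent modulo \<open>N\<close>,
  since one further commutator with \<open>C\<close> leads from \<open>M\<close> into \<open>N\<close>. This contradiction shows that
  \<open>fc_step G N = N\<close> (\<open>maximal_not_virtually_nilpotent_fc_closed\<close>), with \<open>N \<noteq> G\<close>.
\<close>

section \<open>Cosets and subgroups of finite index\<close>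

lemma finite_image_factor:
  assumes "finite (f ` A)" and "\<And>x y. x \<in> A \<Longrightarrow> y \<in> A \<Longrightarrow> f x = f y \<Longrightarrow> g x = g y"
  shows "finite (g ` A)"
proof -
  have "g ` A \<subseteq> (\<lambda>c. g (SOME a. a \<in> A \<and> f a = c)) ` f ` A"
  proof
    fix z assume "z \<in> g ` A"
    then obtain a where a: "a \<in> A" "z = g a" by blast
    let ?b = "SOME b. b \<in> A \<and> f b = f a"
    have "?b \<in> A \<and> f ?b = f a" by (rule someI[of _ a]) (use a in simp)
    then have "g ?b = z" using assms(2)[of ?b a] a by simp
    then show "z \<in> (\<lambda>c. g (SOME a. a \<in> A \<and> f a = c)) ` f ` A"
      using a by blast
  qed
  then show ?thesis using assms(1) finite_surj by blast
qed

context group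
begin

lemma mult_inv_cancel:
  assumes "a \<in> carrier G" "z \<in> carrier G"
  shows "a \<otimes> (inv a \<otimes> z) = z" "inv a \<otimes> (a \<otimes> z) = z"
  using assms by (simp_all flip: m_assoc)

lemma rcos_eq_iff:
  assumes "subgroup H G" "g \<in> carrier G" "h \<in> carrier G"
  shows "H #> g = H #> h \<longleftrightarrow> g \<otimes> inv h \<in> H"
  using coset_mult_inv1[of H g h] coset_mult_inv2[of H g h]
    coset_join1[of H "g \<otimes> inv h"] coset_join2[of "g \<otimes> inv h" H]
    subgroup.subset[OF assms(1)] assms m_closed inv_closed
  by metis

lemma rcosets_eq_image: "rcosets H = (\<lambda>g. H #> g) ` carrier G"
  by (auto simp: RCOSETS_def)

lemma finite_rcosetsI:
  assumes "subgroup H G" "finite (f ` carrier G)"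
    and "\<And>g h. g \<in> carrier G \<Longrightarrow> h \<in> carrier G \<Longrightarrow> f g = f h \<Longrightarrow> g \<otimes> inv h \<in> H"
  shows "finite (rcosets H)"
  unfolding rcosets_eq_image
  by (rule finite_image_factor[OF assms(2)]) (simp add: assms rcos_eq_iff)

lemma finite_rcosets_Int:
  assumes H: "subgroup H G" "finite (rcosets H)" and K: "subgroup K G" "finite (rcosets K)"
  shows "finite (rcosets (H \<inter> K))"
proof (rule finite_rcosetsI[where f = "\<lambda>g. (H #> g, K #> g)"])
  show "subgroup (H \<inter> K) G" using H K subgroups_Inter_pair by blast
  have "(\<lambda>g. (H #> g, K #> g)) ` carrier G \<subseteq> (rcosets H) \<times> (rcosets K)"
    by (auto simp: rcosets_eq_image)
  then show "finite ((\<lambda>g. (H #> g, K #> g)) ` carrier G)"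
    using H K finite_subset by blast
qed (use H K in \<open>simp add: rcos_eq_iff\<close>)

text \<open>
  Schreier's argument: for a set \<open>R\<close> of coset representatives, moving a representative past a
  generator of \<open>G\<close> costs one of the finitely many elements \<open>r \<otimes> s \<otimes> inv r'\<close> of \<open>H\<close>. Pushing
  \<open>\<one>\<close> through a word for \<open>h \<in> H\<close> therefore writes \<open>h\<close> as a product of such elements and a
  representative that itself lies in \<open>H\<close>.
\<close>
lemma finitely_generated_finite_index:
  assumes fg: "finitely_generated_group G" and H: "subgroup H G" and fin: "finite (rcosets H)"
  shows "finitely_generated_group (G\<lparr>carrier := H\<rparr>)"
proof -
  obtain S where S: "S \<subseteq> carrier G" "finite S" "generate G S = carrier G"
    using fg by (auto simp: finitely_generated_group_def)
  obtain R0 where R0: "R0 \<subseteq> carrier G" "finite R0" "(\<lambda>g. H #> g) ` R0 = rcosets H"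
    using fin finite_subset_image[of "rcosets H" "\<lambda>g. H #> g" "carrier G"]
    by (metis rcosets_eq_image order_refl)
  define R where "R = insert \<one> R0"
  have R: "R \<subseteq> carrier G" "finite R" "\<one> \<in> R" using R0 by (auto simp: R_def)
  have rep: "\<exists>r \<in> R. g \<otimes> inv r \<in> H" if g: "g \<in> carrier G" for g
  proof -
    have "H #> g \<in> (\<lambda>g. H #> g) ` R0" using g R0 by (auto simp: rcosets_eq_image)
    then obtain r where "r \<in> R0" "H #> g = H #> r" by blast
    then show ?thesis using rcos_eq_iff[OF H g, of r] R0 by (auto simp: R_def)
  qed
  define S' where "S' = S \<union> (\<lambda>s. inv s) ` S"
  have S': "S' \<subseteq> carrier G" "finite S'" using S by (auto simp: S'_def)
  define U where
    "U = ((\<lambda>(r, s, r'). r \<otimes> s \<otimes> inv r') ` (R \<times> S' \<times> R) \<union> R) \<inter> H"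
  have U: "finite U" "U \<subseteq> H" using R S' by (auto simp: U_def)
  then have UG: "U \<subseteq> carrier G" using subgroup.subset[OF H] by blast
  let ?K = "generate G U"
  have K: "subgroup ?K G" by (rule generate_is_subgroup[OF UG])
  have KH: "?K \<subseteq> H" by (rule generate_subgroup_incl[OF U(2) H])
  have letter: "\<exists>k \<in> ?K. \<exists>r' \<in> R. r \<otimes> s = k \<otimes> r'" if s: "s \<in> S'" and r: "r \<in> R" for r s
  proof -
    have c: "r \<in> carrier G" "s \<in> carrier G" using r s R S' by auto
    then obtain r' where r': "r' \<in> R" "r \<otimes> s \<otimes> inv r' \<in> H" using rep[of "r \<otimes> s"] by auto
    have "r \<otimes> s \<otimes> inv r' \<in> U" unfolding U_def using r s r' by force
    moreover have "r \<otimes> s = r \<otimes> s \<otimes> inv r' \<otimes> r'"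
      using c r' R by (metis inv_solve_right' m_closed inv_closed subsetD)
    ultimately show ?thesis using r' generate.incl by metis
  qed
  have word: "\<forall>r \<in> R. \<exists>k \<in> ?K. \<exists>r' \<in> R. r \<otimes> g = k \<otimes> r'" if "g \<in> generate G S" for g
    using that
  proof (induction rule: generate.induct)
    case one
    show ?case
    proof
      fix r assume "r \<in> R"
      then show "\<exists>k \<in> ?K. \<exists>r' \<in> R. r \<otimes> \<one> = k \<otimes> r'"
        using R by (intro bexI[of _ \<one>] bexI[of _ r]) (auto intro: generate.one)
    qed
  next
    case (eng h1 h2)
    show ?case
    proof
      fix r assume r: "r \<in> R"
      obtain k1 r1 where 1: "k1 \<in> ?K" "r1 \<in> R" "r \<otimes> h1 = k1 \<otimes> r1" using eng r by blast
      obtain k2 r2 where 2: "k2 \<in> ?K" "r2 \<in> R" "r1 \<otimes> h2 = k2 \<otimes> r2" using eng 1 by blast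
      have c: "r \<in> carrier G" "h1 \<in> carrier G" "h2 \<in> carrier G" "k1 \<in> carrier G"
        "r1 \<in> carrier G" "k2 \<in> carrier G" "r2 \<in> carrier G"
        using r R 1 2 eng S subgroup.subset[OF K] by auto
      have "r \<otimes> (h1 \<otimes> h2) = k1 \<otimes> (r1 \<otimes> h2)" using c 1(3) by (simp flip: m_assoc)
      also have "\<dots> = (k1 \<otimes> k2) \<otimes> r2" using c 2(3) by (simp add: m_assoc)
      finally show "\<exists>k \<in> ?K. \<exists>r' \<in> R. r \<otimes> (h1 \<otimes> h2) = k \<otimes> r'"
        using 1 2 generate.eng by metis
    qed
  qed (use letter in \<open>auto simp: S'_def\<close>)
  have "H \<subseteq> ?K"
  proof
    fix h assume h: "h \<in> H"
    then have hG: "h \<in> carrier G" using subgroup.subset[OF H] by blast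
    then obtain k r where kr: "k \<in> ?K" "r \<in> R" "\<one> \<otimes> h = k \<otimes> r" using word[of h] S R by auto
    have c: "k \<in> carrier G" "r \<in> carrier G" using kr R subgroup.subset[OF K] by auto
    have "r = inv k \<otimes> h" using kr c hG mult_inv_cancel(2)[of k r] by simp
    then have "r \<in> H" using kr KH h subgroup.m_closed[OF H] subgroup.m_inv_closed[OF H] by auto
    then have "r \<in> ?K" using kr by (auto simp: U_def intro: generate.incl)
    then show "h \<in> ?K" using kr hG generate.eng[of k G U r] by simp
  qed
  then have "generate (G\<lparr>carrier := H\<rparr>) U = H"
    using KH generate_consistent[OF U(2) H] by auto
  then show ?thesis using U by (auto simp: finitely_generated_group_def)
qed


section \<open>Centralizers modulo a normal subgroup\<close>

text \<open>The preimage in \<open>G\<close> of the centralizer of the image of \<open>X\<close> in \<open>G / N\<close>.\<close>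
definition centralizer_mod :: "'a set \<Rightarrow> 'a set \<Rightarrow> 'a set" where
  "centralizer_mod N X = {g \<in> carrier G. \<forall>x \<in> X. N #> (g \<otimes> x) = N #> (x \<otimes> g)}"

lemma rcos_cong:
  assumes N: "N \<lhd> G"
    and c: "a \<in> carrier G" "b \<in> carrier G" "u \<in> carrier G" "v \<in> carrier G"
    and eq: "N #> u = N #> v"
  shows "N #> (a \<otimes> u \<otimes> b) = N #> (a \<otimes> v \<otimes> b)"
  using c eq normal.rcos_sum[OF N] by (metis m_closed)

lemma centralizer_mod_iff_commutator:
  assumes N: "N \<lhd> G" and X: "X \<subseteq> carrier G"
  shows "g \<in> centralizer_mod N X \<longleftrightarrow>
    g \<in> carrier G \<and> (\<forall>x \<in> X. g \<otimes> x \<otimes> inv g \<otimes> inv x \<in> N)"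
proof -
  have "N #> (g \<otimes> x) = N #> (x \<otimes> g) \<longleftrightarrow> g \<otimes> x \<otimes> inv g \<otimes> inv x \<in> N"
    if "g \<in> carrier G" "x \<in> X" for x
    using that X rcos_eq_iff[OF normal_imp_subgroup[OF N], of "g \<otimes> x" "x \<otimes> g"]
    by (auto simp: inv_mult_group m_assoc subset_iff)
  then show ?thesis by (auto simp: centralizer_mod_def)
qed

lemma centralizer_mod_subgroup:
  assumes N: "N \<lhd> G" and X: "X \<subseteq> carrier G"
  shows "subgroup (centralizer_mod N X) G"
proof (rule subgroupI)
  show "centralizer_mod N X \<subseteq> carrier G" by (auto simp: centralizer_mod_def)
  have "\<one> \<in> centralizer_mod N X" using X by (auto simp: centralizer_mod_def)
  then show "centralizer_mod N X \<noteq> {}" by blast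
next
  fix a assume a: "a \<in> centralizer_mod N X"
  then have ac: "a \<in> carrier G" by (simp add: centralizer_mod_def)
  have "N #> (inv a \<otimes> x) = N #> (x \<otimes> inv a)" if x: "x \<in> X" for x
  proof -
    have xc: "x \<in> carrier G" using x X by blast
    have "N #> (x \<otimes> a) = N #> (a \<otimes> x)" using a x by (simp add: centralizer_mod_def)
    from rcos_cong[OF N _ _ _ _ this, of "inv a" "inv a"] show ?thesis
      using ac xc by (simp add: m_assoc mult_inv_cancel)
  qed
  then show "inv a \<in> centralizer_mod N X" using ac by (simp add: centralizer_mod_def)
next
  fix a b assume a: "a \<in> centralizer_mod N X" and b: "b \<in> centralizer_mod N X"
  then have c: "a \<in> carrier G" "b \<in> carrier G" by (auto simp: centralizer_mod_def)
  have "N #> (a \<otimes> b \<otimes> x) = N #> (x \<otimes> (a \<otimes> b))" if x: "x \<in> X" for x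
  proof -
    have xc: "x \<in> carrier G" using x X by blast
    have eqs: "N #> (b \<otimes> x) = N #> (x \<otimes> b)" "N #> (a \<otimes> x) = N #> (x \<otimes> a)"
      using a b x by (auto simp: centralizer_mod_def)
    show ?thesis
      using rcos_cong[OF N _ _ _ _ eqs(1), of a \<one>] rcos_cong[OF N _ _ _ _ eqs(2), of \<one> b]
        c xc by (simp add: m_assoc)
  qed
  then show "a \<otimes> b \<in> centralizer_mod N X" using c by (simp add: centralizer_mod_def)
qed

lemma centralizer_mod_normal:
  assumes N: "N \<lhd> G" and X: "X \<subseteq> carrier G"
    and conj: "\<And>a x. a \<in> carrier G \<Longrightarrow> x \<in> X \<Longrightarrow> a \<otimes> x \<otimes> inv a \<in> X"
  shows "centralizer_mod N X \<lhd> G"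
  unfolding normal_inv_iff
proof (intro conjI ballI)
  show "subgroup (centralizer_mod N X) G" by (rule centralizer_mod_subgroup[OF N X])
  fix a g assume a: "a \<in> carrier G" and g: "g \<in> centralizer_mod N X"
  then have gc: "g \<in> carrier G" by (simp add: centralizer_mod_def)
  have "N #> (a \<otimes> g \<otimes> inv a \<otimes> x) = N #> (x \<otimes> (a \<otimes> g \<otimes> inv a))" if x: "x \<in> X" for x
  proof -
    have xc: "x \<in> carrier G" using x X by blast
    have "inv a \<otimes> x \<otimes> a \<in> X" using conj[of "inv a" x] a x by simp
    then have "N #> (g \<otimes> (inv a \<otimes> x \<otimes> a)) = N #> (inv a \<otimes> x \<otimes> a \<otimes> g)"
      using g by (simp add: centralizer_mod_def)
    from rcos_cong[OF N _ _ _ _ this, of a "inv a"] show ?thesis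
      using a gc xc by (simp add: m_assoc mult_inv_cancel)
  qed
  then show "a \<otimes> g \<otimes> inv a \<in> centralizer_mod N X"
    using a gc by (simp add: centralizer_mod_def)
qed

lemma normal_subset_centralizer_mod:
  assumes N: "N \<lhd> G" and X: "X \<subseteq> carrier G"
  shows "N \<subseteq> centralizer_mod N X"
proof
  interpret normal N G by (rule N)
  fix g assume g: "g \<in> N"
  have "g \<otimes> x \<otimes> inv g \<otimes> inv x \<in> N" if x: "x \<in> X" for x
  proof -
    have xc: "x \<in> carrier G" using x X by blast
    have "g \<otimes> (x \<otimes> inv g \<otimes> inv x) \<in> N" using g xc by (intro m_closed inv_op_closed2) auto
    then show ?thesis using g xc by (simp add: m_assoc)
  qed
  then show "g \<in> centralizer_mod N X"
    using centralizer_mod_iff_commutator[OF N X] g by auto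
qed


section \<open>FC-elements modulo a normal subgroup\<close>

lemma fc_step_iff:
  assumes N: "N \<lhd> G"
  shows "g \<in> fc_step G N \<longleftrightarrow>
    g \<in> carrier G \<and> finite ((\<lambda>c. N #> c) ` conjugates G g)"
proof -
  interpret N: normal N G by (rule N)
  interpret Q: group "G Mod N" by (rule N.factorgroup_is_group)
  interpret h: group_hom G "G Mod N" "\<lambda>g. N #> g"
    by unfold_locales (rule N.r_coset_hom_Mod)
  have "conjugates (G Mod N) (N #> g) = (\<lambda>c. N #> c) ` conjugates G g" if g: "g \<in> carrier G"
  proof -
    have "(N #> x) \<otimes>\<^bsub>G Mod N\<^esub> (N #> g) \<otimes>\<^bsub>G Mod N\<^esub> inv\<^bsub>G Mod N\<^esub> (N #> x) = N #> (x \<otimes> g \<otimes> inv x)"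
      if "x \<in> carrier G" for x
      by (simp only: h.hom_mult h.hom_inv that g m_closed inv_closed)
    then show ?thesis
      unfolding conjugates_def carrier_FactGroup image_image by (rule image_cong[OF refl])
  qed
  then show ?thesis
    using h.hom_closed by (auto simp: fc_step_def fc_center_def)
qed

lemma fc_step_mono:
  assumes M: "M \<lhd> G" and N: "N \<lhd> G" and sub: "M \<subseteq> N"
  shows "fc_step G M \<subseteq> fc_step G N"
proof
  fix g assume "g \<in> fc_step G M"
  then have g: "g \<in> carrier G" "finite ((\<lambda>c. M #> c) ` conjugates G g)"
    using fc_step_iff[OF M] by auto
  have "finite ((\<lambda>c. N #> c) ` conjugates G g)"
  proof (rule finite_image_factor[OF g(2)])
    fix x y assume "x \<in> conjugates G g" "y \<in> conjugates G g" "M #> x = M #> y"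
    moreover from this have "x \<in> carrier G" "y \<in> carrier G"
      using g(1) by (auto simp: conjugates_def)
    ultimately show "N #> x = N #> y"
      using sub rcos_eq_iff[OF normal_imp_subgroup[OF M], of x y]
        rcos_eq_iff[OF normal_imp_subgroup[OF N], of x y] by blast
  qed
  then show "g \<in> fc_step G N" using fc_step_iff[OF N] g by auto
qed

lemma icc_group_Mod_iff:
  assumes N: "N \<lhd> G"
  shows "icc_group (G Mod N) \<longleftrightarrow> fc_step G N = N"
proof -
  interpret N: normal N G by (rule N)
  have triv: "N #> g = N \<longleftrightarrow> g \<in> N" if "g \<in> carrier G" for g
    using that coset_join1[of N g] coset_join2[of g N] N.subgroup_axioms by auto
  have "icc_group (G Mod N) \<longleftrightarrow> fc_step G N \<subseteq> N"
    unfolding icc_group_def carrier_FactGroup fc_step_def fc_center_def using triv by auto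
  then show ?thesis using fc_step_increasing[OF N] by blast
qed

lemma trivial_Mod_iff:
  assumes N: "N \<lhd> G"
  shows "carrier (G Mod N) = {\<one>\<^bsub>G Mod N\<^esub>} \<longleftrightarrow> N = carrier G"
proof -
  interpret N: normal N G by (rule N)
  have "N #> g = N \<longleftrightarrow> g \<in> N" if "g \<in> carrier G" for g
    using that coset_join1[of N g] coset_join2[of g N] N.subgroup_axioms by auto
  then have "carrier (G Mod N) = {\<one>\<^bsub>G Mod N\<^esub>} \<longleftrightarrow> carrier G \<subseteq> N"
    unfolding carrier_FactGroup by auto
  then show ?thesis using N.subset by blast
qed

lemma hyper_fc_center_least:
  assumes N: "N \<lhd> G" and closed: "fc_step G N = N"
  shows "hyper_fc_center G \<subseteq> N"
proof -
  let ?r = "fc_ordinals G"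
  note wo = Well_order_fc_ordinals
  interpret wo_rel ?r using wo by (simp add: wo_rel_def)
  have "upper_fc_series G ?r \<alpha> \<subseteq> N" for \<alpha>
  proof (induction \<alpha> rule: well_order_induct)
    case (1 \<alpha>)
    then have IH: "upper_fc_series G ?r \<beta> \<subseteq> N" if "\<beta> \<in> underS \<alpha>" for \<beta>
      using that by (auto simp: underS_def)
    consider "underS \<alpha> = {}" | \<beta> where "underS \<alpha> \<noteq> {}" "underS \<alpha> = under \<beta>"
      | "underS \<alpha> \<noteq> {}" "\<nexists>\<beta>. underS \<alpha> = under \<beta>" by blast
    then show ?case
    proof cases
      case 1
      then show ?thesis
        using upper_fc_series_zero[OF wo, where G = G]
          subgroup.one_closed[OF normal_imp_subgroup[OF N]] by auto
    next
      case (2 \<beta>)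
      then have b: "\<beta> \<in> Field ?r" by (auto simp: under_def Field_def)
      then have "\<beta> \<in> underS \<alpha>" using 2 REFL by (auto simp: under_def refl_on_def)
      then show ?thesis
        using upper_fc_series_succ[OF wo b, where G = G] 2 closed IH
          fc_step_mono[OF upper_fc_series_normal[OF wo] N] by metis
    next
      case 3
      then show ?thesis using upper_fc_series_limit[OF wo, where G = G] IH by blast
    qed
  qed
  then show ?thesis by (simp add: hyper_fc_center_def)
qed

lemma hyper_fc_central_iff_no_proper_fc_closed:
  "hyper_fc_central G \<longleftrightarrow> (\<forall>N. N \<lhd> G \<and> fc_step G N = N \<longrightarrow> N = carrier G)"
proof
  assume "hyper_fc_central G"
  then show "\<forall>N. N \<lhd> G \<and> fc_step G N = N \<longrightarrow> N = carrier G"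
    using hyper_fc_center_least subgroup.subset[OF normal_imp_subgroup]
    unfolding hyper_fc_central_def by blast
next
  assume "\<forall>N. N \<lhd> G \<and> fc_step G N = N \<longrightarrow> N = carrier G"
  moreover have "hyper_fc_center G \<lhd> G"
    unfolding hyper_fc_center_def by (rule upper_fc_series_normal[OF Well_order_fc_ordinals])
  ultimately show "hyper_fc_central G"
    using fc_step_hyper_fc_center by (simp add: hyper_fc_central_def)
qed

text \<open>
  If \<open>H\<close> centralizes \<open>x\<close> modulo \<open>N\<close>, then the conjugate \<open>inv a \<otimes> x \<otimes> a\<close> depends, modulo \<open>N\<close>,
  only on the right coset of \<open>H\<close> that contains \<open>a\<close>.
\<close>
lemma finite_index_centralizer_imp_fc:
  assumes N: "N \<lhd> G" and H: "subgroup H G" "finite (rcosets H)"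
    and x: "x \<in> centralizer_mod N H"
  shows "x \<in> fc_step G N"
proof -
  have xc: "x \<in> carrier G" using x by (simp add: centralizer_mod_def)
  have "finite ((\<lambda>a. N #> (inv a \<otimes> x \<otimes> a)) ` carrier G)"
  proof (rule finite_image_factor[where f = "\<lambda>a. H #> a"])
    show "finite ((\<lambda>a. H #> a) ` carrier G)" using H by (simp add: rcosets_eq_image)
    fix a b assume c: "a \<in> carrier G" "b \<in> carrier G" and "H #> a = H #> b"
    then have h: "a \<otimes> inv b \<in> H" using rcos_eq_iff[OF H(1)] by blast
    let ?h = "a \<otimes> inv b"
    have "N #> (x \<otimes> ?h) = N #> (?h \<otimes> x)" using x h by (simp add: centralizer_mod_def)
    from rcos_cong[OF N _ _ _ _ this, of "inv a" b]
    show "N #> (inv a \<otimes> x \<otimes> a) = N #> (inv b \<otimes> x \<otimes> b)"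
      using c xc by (simp add: m_assoc mult_inv_cancel)
  qed
  moreover have "(\<lambda>c. N #> c) ` conjugates G x \<subseteq> (\<lambda>a. N #> (inv a \<otimes> x \<otimes> a)) ` carrier G"
  proof
    fix z assume "z \<in> (\<lambda>c. N #> c) ` conjugates G x"
    then obtain a where "a \<in> carrier G" "z = N #> (a \<otimes> x \<otimes> inv a)"
      by (auto simp: conjugates_def)
    then show "z \<in> (\<lambda>a. N #> (inv a \<otimes> x \<otimes> a)) ` carrier G"
      by (intro image_eqI[of _ _ "inv a"]) auto
  qed
  ultimately show ?thesis using fc_step_iff[OF N] xc finite_subset by blast
qed

lemma conjugates_closed:
  assumes "x \<in> carrier G" "a \<in> carrier G" "c \<in> conjugates G x"
  shows "a \<otimes> c \<otimes> inv a \<in> conjugates G x"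
proof -
  obtain b where b: "b \<in> carrier G" "c = b \<otimes> x \<otimes> inv b" using assms by (auto simp: conjugates_def)
  then have "a \<otimes> c \<otimes> inv a = (a \<otimes> b) \<otimes> x \<otimes> inv (a \<otimes> b)"
    using assms by (simp add: m_assoc inv_mult_group)
  then show ?thesis using assms b by (auto simp: conjugates_def)
qed

text \<open>
  Conjugation lets \<open>G\<close> permute the finitely many conjugates of \<open>x\<close> modulo \<open>N\<close>, and the
  centralizer of these conjugates is the kernel of this action.
\<close>
lemma finite_index_centralizer_of_conjugates:
  assumes N: "N \<lhd> G" and x: "x \<in> fc_step G N"
  shows "finite (rcosets (centralizer_mod N (conjugates G x)))"
proof -
  interpret N: normal N G by (rule N)
  let ?X = "conjugates G x"
  let ?K = "(\<lambda>c. N #> c) ` ?X"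
  have xc: "x \<in> carrier G" and fin: "finite ?K" using x fc_step_iff[OF N] by auto
  have X: "?X \<subseteq> carrier G" using xc by (auto simp: conjugates_def)
  have sub: "subgroup (centralizer_mod N ?X) G" by (rule centralizer_mod_subgroup[OF N X])
  \<comment> \<open>Acting by \<open>inv g\<close> makes equal actions of \<open>g\<close> and \<open>h\<close> give equal right cosets.\<close>
  define act where "act g = (\<lambda>k \<in> ?K. (N #> inv g) <#> k <#> (N #> g))" for g
  have act: "(N #> inv g) <#> (N #> c) <#> (N #> g) = N #> (inv g \<otimes> c \<otimes> g)"
    if "g \<in> carrier G" "c \<in> ?X" for g c
    using that X by (simp add: N.rcos_sum subset_iff)
  show ?thesis
  proof (rule finite_rcosetsI[OF sub, where f = act])
    have "act ` carrier G \<subseteq> ?K \<rightarrow>\<^sub>E ?K"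
    proof
      fix z assume "z \<in> act ` carrier G"
      then obtain g where g: "g \<in> carrier G" "z = act g" by blast
      have "N #> (inv g \<otimes> c \<otimes> g) \<in> ?K" if "c \<in> ?X" for c
        using conjugates_closed[OF xc, of "inv g" c] that g by auto
      then show "z \<in> ?K \<rightarrow>\<^sub>E ?K" using g act by (auto simp: act_def)
    qed
    then show "finite (act ` carrier G)" using fin finite_PiE[of ?K "\<lambda>_. ?K"] finite_subset by blast
  next
    fix g h assume g: "g \<in> carrier G" and h: "h \<in> carrier G" and eq: "act g = act h"
    have "N #> ((g \<otimes> inv h) \<otimes> c) = N #> (c \<otimes> (g \<otimes> inv h))" if c: "c \<in> ?X" for c
    proof -
      have cc: "c \<in> carrier G" using c X by blast
      have "act g (N #> c) = act h (N #> c)" using eq by simp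
      then have "N #> (inv g \<otimes> c \<otimes> g) = N #> (inv h \<otimes> c \<otimes> h)"
        using act[OF g c] act[OF h c] c by (simp add: act_def)
      from rcos_cong[OF N _ _ _ _ this, of g "inv h"] show ?thesis
        using g h cc by (simp add: m_assoc mult_inv_cancel)
    qed
    then show "g \<otimes> inv h \<in> centralizer_mod N ?X" using g h by (simp add: centralizer_mod_def)
  qed
qed


section \<open>The lower central series modulo a normal subgroup\<close>

lemma lower_central_series_subgroup: "subgroup (lower_central_series G n) G"
proof (induction n)
  case 0
  then show ?case by (simp add: subgroup_self)
next
  case (Suc n)
  have "lower_central_series G n \<subseteq> carrier G" by (rule subgroup.subset[OF Suc])
  then show ?case by (auto intro!: generate_is_subgroup)
qed

lemma lower_central_series_restrict_subset:
  assumes "subgroup H G"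
  shows "lower_central_series (G\<lparr>carrier := H\<rparr>) n \<subseteq> H"
  using subgroup.subset[OF group.lower_central_series_subgroup[OF subgroup_imp_group[OF assms]], of n]
  by simp

lemma lower_central_series_restrict_Suc:
  assumes H: "subgroup H G"
  shows "lower_central_series (G\<lparr>carrier := H\<rparr>) (Suc n) =
    generate G (\<Union>x \<in> lower_central_series (G\<lparr>carrier := H\<rparr>) n. \<Union>y \<in> H.
      {x \<otimes> y \<otimes> inv x \<otimes> inv y})"
proof -
  let ?L = "lower_central_series (G\<lparr>carrier := H\<rparr>) n"
  have L: "?L \<subseteq> H" by (rule lower_central_series_restrict_subset[OF H])
  have eq: "(\<Union>x \<in> ?L. \<Union>y \<in> H. {x \<otimes> y \<otimes> inv\<^bsub>G\<lparr>carrier := H\<rparr>\<^esub> x \<otimes> inv\<^bsub>G\<lparr>carrier := H\<rparr>\<^esub> y})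
      = (\<Union>x \<in> ?L. \<Union>y \<in> H. {x \<otimes> y \<otimes> inv x \<otimes> inv y})"
    using L m_inv_consistent[OF H] by (intro SUP_cong refl) (auto simp: subset_iff)
  have "(\<Union>x \<in> ?L. \<Union>y \<in> H. {x \<otimes> y \<otimes> inv x \<otimes> inv y}) \<subseteq> H"
    using L subgroup.m_closed[OF H] subgroup.m_inv_closed[OF H] by auto
  from generate_consistent[OF this H] show ?thesis by (simp add: eq)
qed

lemma lower_central_series_restrict_mono:
  assumes K: "subgroup K G" and H: "subgroup H G" and sub: "K \<subseteq> H"
  shows "lower_central_series (G\<lparr>carrier := K\<rparr>) n \<subseteq> lower_central_series (G\<lparr>carrier := H\<rparr>) n"
proof (induction n)
  case 0
  then show ?case using sub by simp
next
  case (Suc n)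
  then show ?case
    unfolding lower_central_series_restrict_Suc[OF H] lower_central_series_restrict_Suc[OF K]
    using sub by (intro mono_generate) blast
qed

text \<open>
  Both sides say that \<open>H\<close> acts trivially, modulo \<open>N\<close>, on the \<open>n\<close>-th term of its lower central
  series. Read from left to right it moves up the series and pays with a larger subgroup; read from
  right to left it is how a central extension raises the nilpotency class by one.
\<close>
lemma lower_central_series_restrict_Suc_subset_iff:
  assumes N: "N \<lhd> G" and H: "subgroup H G"
  shows "lower_central_series (G\<lparr>carrier := H\<rparr>) (Suc n) \<subseteq> N \<longleftrightarrow>
    lower_central_series (G\<lparr>carrier := H\<rparr>) n \<subseteq> centralizer_mod N H"
proof -
  let ?L = "lower_central_series (G\<lparr>carrier := H\<rparr>) n"
  let ?C = "\<Union>x \<in> ?L. \<Union>y \<in> H. {x \<otimes> y \<otimes> inv x \<otimes> inv y}"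
  have HG: "H \<subseteq> carrier G" by (rule subgroup.subset[OF H])
  have "lower_central_series (G\<lparr>carrier := H\<rparr>) (Suc n) \<subseteq> N \<longleftrightarrow> ?C \<subseteq> N"
    unfolding lower_central_series_restrict_Suc[OF H]
    using generate_subgroup_incl[OF _ normal_imp_subgroup[OF N], of ?C]
      generate.incl[of _ ?C G] by blast
  also have "\<dots> \<longleftrightarrow> (\<forall>x \<in> ?L. \<forall>y \<in> H. x \<otimes> y \<otimes> inv x \<otimes> inv y \<in> N)" by blast
  also have "\<dots> \<longleftrightarrow> ?L \<subseteq> centralizer_mod N H"
    unfolding subset_iff centralizer_mod_iff_commutator[OF N HG]
    using HG lower_central_series_restrict_subset[OF H, of n] by blast
  finally show ?thesis .
qed

primrec iterated_commutators :: "'a set \<Rightarrow> nat \<Rightarrow> 'a set" where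
  "iterated_commutators T 0 = T"
| "iterated_commutators T (Suc n) =
     (\<lambda>(s, t). s \<otimes> t \<otimes> inv s \<otimes> inv t) ` (iterated_commutators T n \<times> T)"

lemma finite_iterated_commutators: "finite T \<Longrightarrow> finite (iterated_commutators T n)"
  by (induction n) auto

lemma iterated_commutators_subset:
  assumes "T \<subseteq> carrier G"
  shows "iterated_commutators T n \<subseteq> lower_central_series G n"
proof (induction n)
  case (Suc n)
  then show ?case using assms by (auto intro!: generate.incl)
qed (use assms in simp)

text \<open>
  Induction on \<open>n\<close> for all \<open>M\<close> simultaneously: if \<open>M\<close> contains \<open>iterated_commutators T (Suc n)\<close>,
  then the elements of \<open>iterated_commutators T n\<close> commute modulo \<open>M\<close> with all generators, hence
  lie in the normal subgroup of elements that are central modulo \<open>M\<close>. The induction hypothesis is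
  used for this normal subgroup.
\<close>
lemma lower_central_series_subset_normal:
  assumes T: "T \<subseteq> carrier G" "generate G T = carrier G"
  shows "M \<lhd> G \<Longrightarrow> iterated_commutators T n \<subseteq> M \<Longrightarrow> lower_central_series G n \<subseteq> M"
proof (induction n arbitrary: M)
  case 0
  then show ?case
    using generate_subgroup_incl[OF _ normal_imp_subgroup[of M], of T] T by auto
next
  case (Suc n)
  let ?Z = "centralizer_mod M (carrier G)"
  have M: "M \<lhd> G" by (rule Suc.prems)
  have Z: "?Z \<lhd> G" by (rule centralizer_mod_normal[OF M]) auto
  have "iterated_commutators T n \<subseteq> ?Z"
  proof
    fix s assume s: "s \<in> iterated_commutators T n"
    then have sc: "s \<in> carrier G"
      using iterated_commutators_subset[OF T(1), of n]
        subgroup.subset[OF lower_central_series_subgroup[of n]] by blast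
    have "s \<in> centralizer_mod M T"
      using Suc.prems(2) s sc centralizer_mod_iff_commutator[OF M T(1)] by auto
    then have "T \<subseteq> centralizer_mod M {s}"
      using T by (auto simp: centralizer_mod_def)
    then have "carrier G \<subseteq> centralizer_mod M {s}"
      using generate_subgroup_incl[OF _ centralizer_mod_subgroup[OF M, of "{s}"], of T] sc T
      by auto
    then show "s \<in> ?Z" using sc by (auto simp: centralizer_mod_def)
  qed
  from Suc.IH[OF Z this] show ?case
    using lower_central_series_restrict_Suc_subset_iff[OF M subgroup_self, of n]
    by simp
qed

end


section \<open>Virtual nilpotency of quotients\<close>

text \<open>
  For normal \<open>N\<close> this says that \<open>G / N\<close> is virtually nilpotent, as witnessed by the image of
  \<open>H\<close>. Stated in terms of subgroups of \<open>G\<close>, it can be compared for different \<open>N\<close>.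
\<close>
definition virtually_nilpotent_mod :: "('a, 'b) monoid_scheme \<Rightarrow> 'a set \<Rightarrow> bool" where
  "virtually_nilpotent_mod G N \<longleftrightarrow>
     (\<exists>H n. subgroup H G \<and> finite (rcosets\<^bsub>G\<^esub> H) \<and>
       lower_central_series (G\<lparr>carrier := H\<rparr>) n \<subseteq> N)"

context group
begin

lemma virtually_nilpotent_iff_mod_one:
  "virtually_nilpotent G \<longleftrightarrow> virtually_nilpotent_mod G {\<one>}"
proof -
  have eq: "lower_central_series (G\<lparr>carrier := H\<rparr>) n = {\<one>} \<longleftrightarrow>
      lower_central_series (G\<lparr>carrier := H\<rparr>) n \<subseteq> {\<one>}" if "subgroup H G" for H n
    using subgroup.one_closed[OF group.lower_central_series_subgroup[OF subgroup_imp_group[OF that]], of n]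
    by auto
  have "virtually_nilpotent G \<longleftrightarrow> (\<exists>H. subgroup H G \<and> finite (rcosets H) \<and>
      (\<exists>n. lower_central_series (G\<lparr>carrier := H\<rparr>) n = {\<one>}))"
    by (simp add: virtually_nilpotent_def nilpotent_group_def)
  also have "\<dots> \<longleftrightarrow> virtually_nilpotent_mod G {\<one>}"
    unfolding virtually_nilpotent_mod_def using eq[THEN iffD1] eq[THEN iffD2] by blast
  finally show ?thesis .
qed

lemma virtually_nilpotent_imp_no_proper_fc_closed:
  assumes vn: "virtually_nilpotent G" and N: "N \<lhd> G" and closed: "fc_step G N = N"
  shows "N = carrier G"
proof -
  obtain H n where H: "subgroup H G" "finite (rcosets H)"
    and n: "lower_central_series (G\<lparr>carrier := H\<rparr>) n \<subseteq> {\<one>}"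
    using vn virtually_nilpotent_iff_mod_one by (auto simp: virtually_nilpotent_mod_def)
  have NG: "subgroup N G" by (rule normal_imp_subgroup[OF N])
  have descend: "lower_central_series (G\<lparr>carrier := H\<rparr>) k \<subseteq> N \<Longrightarrow> H \<subseteq> N" for k
  proof (induction k)
    case (Suc k)
    then have "lower_central_series (G\<lparr>carrier := H\<rparr>) k \<subseteq> fc_step G N"
      using lower_central_series_restrict_Suc_subset_iff[OF N H(1)]
        finite_index_centralizer_imp_fc[OF N H] by blast
    then show ?case using Suc.IH closed by simp
  qed simp
  have "H \<subseteq> N" using descend[of n] n subgroup.one_closed[OF NG] by blast
  then have "finite (rcosets N)"
    using H NG
    by (intro finite_rcosetsI[where f = "\<lambda>g. H #> g"])
      (auto simp: rcosets_eq_image rcos_eq_iff subset_iff)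
  moreover have "(\<lambda>c. N #> c) ` conjugates G x \<subseteq> rcosets N" if "x \<in> carrier G" for x
    using that by (auto simp: rcosets_eq_image conjugates_def)
  ultimately have "x \<in> fc_step G N" if "x \<in> carrier G" for x
    using fc_step_iff[OF N, of x] that by (meson finite_subset)
  then show ?thesis using closed subgroup.subset[OF NG] by blast
qed

text \<open>
  Virtual nilpotency modulo \<open>\<Union>\<C>\<close> only requires that finitely many iterated commutators belong to
  \<open>\<Union>\<C>\<close>, and a finite subset of \<open>\<Union>\<C>\<close> already lies in one member of the chain.
\<close>
lemma virtually_nilpotent_mod_Union_chain:
  assumes fg: "finitely_generated_group G" and ne: "\<C> \<noteq> {}"
    and nor: "\<And>N. N \<in> \<C> \<Longrightarrow> N \<lhd> G"
    and chain: "\<And>M N. M \<in> \<C> \<Longrightarrow> N \<in> \<C> \<Longrightarrow> M \<subseteq> N \<or> N \<subseteq> M"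
    and vn: "virtually_nilpotent_mod G (\<Union>\<C>)"
  shows "\<exists>N \<in> \<C>. virtually_nilpotent_mod G N"
proof -
  obtain H n where H: "subgroup H G" "finite (rcosets H)"
    and n: "lower_central_series (G\<lparr>carrier := H\<rparr>) n \<subseteq> \<Union>\<C>"
    using vn by (auto simp: virtually_nilpotent_mod_def)
  let ?H = "G\<lparr>carrier := H\<rparr>"
  interpret H: group ?H by (rule subgroup_imp_group[OF H(1)])
  obtain T where T: "T \<subseteq> carrier ?H" "finite T" "generate ?H T = carrier ?H"
    using finitely_generated_finite_index[OF fg H] by (auto simp: finitely_generated_group_def)
  let ?S = "H.iterated_commutators T n"
  have S: "?S \<subseteq> lower_central_series ?H n" by (rule H.iterated_commutators_subset[OF T(1)])
  have "\<exists>N \<in> \<C>. F \<subseteq> N" if "finite F" "F \<subseteq> \<Union>\<C>" for F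
    using that
  proof (induction rule: finite_induct)
    case empty
    then show ?case using ne by auto
  next
    case (insert a F)
    then obtain M N where "M \<in> \<C>" "F \<subseteq> M" "N \<in> \<C>" "a \<in> N" by auto
    then show ?case using chain[of M N] by blast
  qed
  then obtain N where N: "N \<in> \<C>" "?S \<subseteq> N"
    using H.finite_iterated_commutators[OF T(2)] S n by (metis subset_trans)
  have "N \<inter> H \<lhd> ?H"
    unfolding H.normal_inv_iff
  proof (intro conjI ballI)
    interpret N: normal N G by (rule nor[OF N(1)])
    show "subgroup (N \<inter> H) ?H"
      using subgroup_incl[OF subgroups_Inter_pair[OF N.subgroup_axioms H(1)] H(1)] by simp
    show "x \<otimes>\<^bsub>?H\<^esub> h \<otimes>\<^bsub>?H\<^esub> inv\<^bsub>?H\<^esub> x \<in> N \<inter> H" if "x \<in> carrier ?H" "h \<in> N \<inter> H" for x h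
      using that H(1) N.inv_op_closed2[of x h] subgroup.mem_carrier[OF H(1)]
      by (simp add: subgroup.m_closed subgroup.m_inv_closed)
  qed
  moreover have "?S \<subseteq> N \<inter> H"
    using N S lower_central_series_restrict_subset[OF H(1), of n] by blast
  ultimately have "lower_central_series ?H n \<subseteq> N \<inter> H"
    by (rule H.lower_central_series_subset_normal[OF T(1,3)])
  then show ?thesis using N H by (auto simp: virtually_nilpotent_mod_def)
qed

lemma normal_Union_chain:
  assumes ne: "\<C> \<noteq> {}"
    and nor: "\<And>N. N \<in> \<C> \<Longrightarrow> N \<lhd> G"
    and chain: "\<And>M N. M \<in> \<C> \<Longrightarrow> N \<in> \<C> \<Longrightarrow> M \<subseteq> N \<or> N \<subseteq> M"
  shows "\<Union>\<C> \<lhd> G"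
  unfolding normal_inv_iff
proof (intro conjI ballI subgroupI)
  note sub = normal_imp_subgroup[OF nor]
  show "\<Union>\<C> \<subseteq> carrier G" using subgroup.subset[OF sub] by blast
  show "\<Union>\<C> \<noteq> {}" using ne subgroup.one_closed[OF sub] by blast
  show "inv a \<in> \<Union>\<C>" if "a \<in> \<Union>\<C>" for a using that subgroup.m_inv_closed[OF sub] by blast
  show "a \<otimes> b \<in> \<Union>\<C>" if ab: "a \<in> \<Union>\<C>" "b \<in> \<Union>\<C>" for a b
  proof -
    obtain N where "N \<in> \<C>" "a \<in> N" "b \<in> N" using ab chain by (metis UnionE subsetD)
    then show ?thesis using subgroup.m_closed[OF sub] by blast
  qed
  show "x \<otimes> h \<otimes> inv x \<in> \<Union>\<C>" if "x \<in> carrier G" "h \<in> \<Union>\<C>" for x h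
    using that normal.inv_op_closed2[OF nor] by blast
qed

text \<open>
  A normal subgroup \<open>M\<close> larger than \<open>N\<close> contradicts maximality as soon as some normal \<open>C\<close> of finite
  index centralizes \<open>M\<close> modulo \<open>N\<close>: then \<open>C\<close> meets any subgroup that is nilpotent modulo \<open>M\<close> in one
  that is nilpotent modulo \<open>N\<close>. An FC-element \<open>x\<close> modulo \<open>N\<close> outside \<open>N\<close> provides such a pair, with
  \<open>C\<close> the centralizer of its conjugates and \<open>M\<close> the double centralizer, which contains \<open>x\<close>.
\<close>
lemma maximal_not_virtually_nilpotent_fc_closed:
  assumes N: "N \<lhd> G" and not_vn: "\<not> virtually_nilpotent_mod G N"
    and max: "\<And>M. M \<lhd> G \<Longrightarrow> N \<subset> M \<Longrightarrow> virtually_nilpotent_mod G M"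
  shows "fc_step G N = N"
proof (rule ccontr)
  assume "fc_step G N \<noteq> N"
  then obtain x where x: "x \<in> fc_step G N" "x \<notin> N" using fc_step_increasing[OF N] by blast
  then have xc: "x \<in> carrier G" using fc_step_iff[OF N] by blast
  let ?X = "conjugates G x"
  have X: "?X \<subseteq> carrier G" using xc by (auto simp: conjugates_def)
  define C where "C = centralizer_mod N ?X"
  have C: "C \<lhd> G"
    unfolding C_def by (rule centralizer_mod_normal[OF N X]) (rule conjugates_closed[OF xc])
  have CG: "subgroup C G" by (rule normal_imp_subgroup[OF C])
  have Cfin: "finite (rcosets C)"
    unfolding C_def by (rule finite_index_centralizer_of_conjugates[OF N x(1)])
  define M where "M = centralizer_mod N C"
  have M: "M \<lhd> G"
    unfolding M_def
    by (rule centralizer_mod_normal[OF N subgroup.subset[OF CG]]) (rule normal.inv_op_closed2[OF C])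
  have "x \<in> ?X" using xc by (auto simp: conjugates_def intro!: image_eqI[of _ _ \<one>])
  then have "x \<in> M" using xc by (auto simp: M_def C_def centralizer_mod_def)
  moreover have "N \<subseteq> M"
    unfolding M_def by (rule normal_subset_centralizer_mod[OF N subgroup.subset[OF CG]])
  ultimately have "virtually_nilpotent_mod G M" using x by (intro max[OF M]) blast
  then obtain H n where H: "subgroup H G" "finite (rcosets H)"
    and n: "lower_central_series (G\<lparr>carrier := H\<rparr>) n \<subseteq> M"
    by (auto simp: virtually_nilpotent_mod_def)
  have HC: "subgroup (H \<inter> C) G" by (rule subgroups_Inter_pair[OF H(1) CG])
  have "M \<subseteq> centralizer_mod N (H \<inter> C)" by (auto simp: M_def centralizer_mod_def)
  then have "lower_central_series (G\<lparr>carrier := H \<inter> C\<rparr>) (Suc n) \<subseteq> N"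
    using lower_central_series_restrict_mono[OF HC H(1), of n] n
      lower_central_series_restrict_Suc_subset_iff[OF N HC, of n] by blast
  then have "virtually_nilpotent_mod G N"
    using HC finite_rcosets_Int[OF H CG Cfin] unfolding virtually_nilpotent_mod_def by blast
  then show False using not_vn by blast
qed

lemma not_virtually_nilpotent_imp_proper_fc_closed:
  assumes fg: "finitely_generated_group G" and not_vn: "\<not> virtually_nilpotent G"
  shows "\<exists>N. N \<lhd> G \<and> fc_step G N = N \<and> N \<noteq> carrier G"
proof -
  let ?A = "{N. N \<lhd> G \<and> \<not> virtually_nilpotent_mod G N}"
  have "\<exists>N \<in> ?A. \<forall>M \<in> ?A. N \<subseteq> M \<longrightarrow> M = N"
  proof (rule subset_Zorn_nonempty)
    have "{\<one>} \<in> ?A" using not_vn virtually_nilpotent_iff_mod_one one_is_normal by auto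
    then show "?A \<noteq> {}" by blast
    fix \<C> assume ne: "\<C> \<noteq> {}" and ch: "subset.chain ?A \<C>"
    have mem: "N \<lhd> G" "\<not> virtually_nilpotent_mod G N" if "N \<in> \<C>" for N
      using ch that by (auto simp: subset.chain_def)
    have comparable: "M \<subseteq> N \<or> N \<subseteq> M" if "M \<in> \<C>" "N \<in> \<C>" for M N
      using ch that unfolding subset.chain_def by blast
    show "\<Union>\<C> \<in> ?A"
      using normal_Union_chain[OF ne mem(1) comparable]
        virtually_nilpotent_mod_Union_chain[OF fg ne mem(1) comparable] mem(2) by blast
  qed
  then obtain N where N: "N \<lhd> G" "\<not> virtually_nilpotent_mod G N"
    and max: "\<And>M. M \<lhd> G \<Longrightarrow> N \<subset> M \<Longrightarrow> virtually_nilpotent_mod G M" by blast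
  have "N \<noteq> carrier G"
  proof
    assume "N = carrier G"
    then have "virtually_nilpotent_mod G N"
      unfolding virtually_nilpotent_mod_def
      by (intro exI[of _ "carrier G"] exI[of _ 0])
        (auto simp: subgroup_self intro!: finite_rcosetsI[where f = "\<lambda>_. ()"])
    then show False using N by blast
  qed
  then show ?thesis using maximal_not_virtually_nilpotent_fc_closed[OF N max] N by blast
qed

end

theorem theorem1:
  fixes G (structure)
  assumes "group G" and "finitely_generated_group G"
  shows "(virtually_nilpotent G \<longleftrightarrow> hyper_fc_central G) \<and>
         (hyper_fc_central G \<longleftrightarrow>
           (\<forall>N. N \<lhd> G \<and> icc_group (G Mod N) \<longrightarrow> carrier (G Mod N) = {\<one>\<^bsub>G Mod N\<^esub>}))"
proof -
  interpret group G by (rule assms(1))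
  have "virtually_nilpotent G \<longleftrightarrow> (\<forall>N. N \<lhd> G \<and> fc_step G N = N \<longrightarrow> N = carrier G)"
    using virtually_nilpotent_imp_no_proper_fc_closed
      not_virtually_nilpotent_imp_proper_fc_closed[OF assms(2)] by blast
  moreover have "(N \<lhd> G \<and> fc_step G N = N \<longrightarrow> N = carrier G) \<longleftrightarrow>
      (N \<lhd> G \<and> icc_group (G Mod N) \<longrightarrow> carrier (G Mod N) = {\<one>\<^bsub>G Mod N\<^esub>})" for N
    using icc_group_Mod_iff[of N] trivial_Mod_iff[of N] by argo
  ultimately show ?thesis using hyper_fc_central_iff_no_proper_fc_closed by presburger
qed

end
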